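(* Let $p$ be a prime and let $\mathcal{T}=\mathcal{T}(R)$ be a descendant tree of finite $p$-groups with abelian root $R$, with parents defined in one of the three ways (1), (2), (3) below. A uniform warranty for the comparability of the Artin patterns $(\tau(G),\varkappa(G))$ of all vertices $G$ of $\mathcal{T}$, in the sense of the natural partial order, is given by the following restriction of the family of subgroups $(U_i)_{i\in I}$ in the corresponding object $(G,(U_i)_{i\in I})$ of the category $\mathcal{G}_{\mathcal{T}}$ associated with the tree. The restriction depends on the definition of a parent $\pi(G)$ in the descendant tree: (1) $\gamma_2(G)\le U_i$ for all $i\in I$, when $\pi(G)=G/\gamma_c(G)$ with $c=\mathrm{cl}(G)$; (2) $P_1(G)\le U_i$ for all $i\in I$, when $\pi(G)=G/P_{\tilde c-1}(G)$ with $\tilde c=\mathrm{cl}_p(G)$; (3) $G^{(1)}\le U_i$ for all $i\in I$, when $\pi(G)=G/G^{(d-1)}$ with $d=\mathrm{dl}(G)$. That is, in each of the three cases, for every vertex $G\in\mathcal{T}$, every family $(U_i)_{i\in I}$ of subgroups of $G$ satisfying the indicated restriction, and every ancestor $H=\pi^n(G)\in\mathcal{T}$ ($n\ge 0$), the projection $\pi^n:G\to H$ satisfies $\ker(\pi^n)\le U_i$ for all $i\in I$, and, putting $V_i=\pi^n(U_i)$, one has $\tau(H)\preceq\tau(G)$ and $\varkappa(G)\preceq\varkappa(H)$ with respect to $\pi^n$ and the families $(U_i)_{i\in I}$, $(V_i)_{i\in I}$.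
   Context: $\gamma_j(G)$ is the lower central series ($\gamma_1(G)=G$, $\gamma_{j}(G)=[\gamma_{j-1}(G),G]$), $\mathrm{cl}(G)$ the nilpotency class; $P_j(G)$ is the lower exponent-$p$ central series ($P_0(G)=G$, $P_{j}(G)=P_{j-1}(G)^p[G,P_{j-1}(G)]$), $\mathrm{cl}_p(G)$ the lower exponent-$p$ class, i.e. the least $\tilde c$ with $P_{\tilde c}(G)=1$; $G^{(j)}$ is the derived series ($G^{(0)}=G$, $G^{(j)}=[G^{(j-1)},G^{(j-1)}]$), $\mathrm{dl}(G)$ the derived length. $X'=[X,X]$. Descendant tree: for a chosen parent definition, the parent $\pi(G)=G/N$ of $G$ is the quotient of $G$ by the last nontrivial member $N$ of the chosen series, and $\pi:G\to\pi(G)$ also denotes the natural projection. $\mathcal{T}(R)$ consists of the root $R$ and all (isomorphism classes of) finite $p$-groups $G$ such that an iterated parent $\pi^n(G)$ is isomorphic to $R$ for some $n\ge 0$; directed edges are $G\to\pi(G)$ for $G\ne R$, and the root has no parent in the tree. The power $\pi^n:G\to\pi^n(G)$ is the compositum of successive projections along a path of the tree, and $\pi^n(G)$ is called an ancestor of $G$. Category of the tree: the objects of $\mathcal{G}_{\mathcal{T}}$ are pairs $(G,(U_i)_{i\in I})$ of a vertex $G\in\mathcal{T}$ and a family of subgroups $U_i\le G$ of finite index. There is a morphism from $(G,(U_i)_{i\in I})$ to $(H,(V_i)_{i\in I})$ only if $H=\pi^n(G)$ for some $n\ge 0$, and then it is the unique morphism $\pi^n$, which is subject to the constraints $\pi^n(U_i)=V_i$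 and $\ker(\pi^n)\le U_i$ for all $i\in I$. Artin pattern: for a subgroup $U\le G$ of finite index $m$ with left transversal $(\ell_1,\ldots,\ell_m)$, and $\lambda_x\in S_m$ given by $x\ell_iU=\ell_{\lambda_x(i)}U$, the Artin transfer is the homomorphism $T_{G,U}:G\to U/U'$, $T_{G,U}(x)=\prod_{i=1}^m\ell_{\lambda_x(i)}^{-1}x\ell_i\cdot U'$. For a family $(U_i)_{i\in I}$ of subgroups of finite index, $\tau(G)=(U_i/U_i')_{i\in I}$ and $\varkappa(G)=(\ker(T_{G,U_i}))_{i\in I}$. Natural order: given an epimorphism $\varphi:G\to H$ with $\varphi(U_i)=V_i$ and $\ker(\varphi)\le U_i$ for all $i\in I$, and induced epimorphisms $\tilde\varphi_i:U_i/U_i'\to V_i/V_i'$, $xU_i'\mapsto\varphi(x)V_i'$: $\tau(H)\preceq\tau(G)$ means $V_i/V_i'\simeq(U_i/U_i')/\ker(\tilde\varphi_i)$ for all $i\in I$; $\varkappa(G)\preceq\varkappa(H)$ means $\varphi(\ker(T_{G,U_i}))\le\ker(T_{H,V_i})$ for all $i\in I$.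
   Formalization: The abelian root R is assumed nontrivial; for R = 1 the claim fails (G = Z/p, H = 1, U = 1: the restriction holds in all three cases, but the kernel of the projection is G, which is not contained in U). *)

theory Defs
  imports "HOL-Algebra.Generated_Groups" "HOL-Algebra.Left_Coset" "HOL-Algebra.FiniteProduct" "HOL-Computational_Algebra.Primes"
begin

section \<open>Central series, derived series and their lengths\<close>

definition commutator_subgroup :: "('a, 'b) monoid_scheme \<Rightarrow> 'a set \<Rightarrow> 'a set \<Rightarrow> 'a set" where
  "commutator_subgroup G H K =
     generate G (\<Union>h\<in>H. \<Union>k\<in>K. {h \<otimes>\<^bsub>G\<^esub> k \<otimes>\<^bsub>G\<^esub> inv\<^bsub>G\<^esub> h \<otimes>\<^bsub>G\<^esub> inv\<^bsub>G\<^esub> k})"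

text \<open>The lower central series is indexed from 1; the value at 0 is a dummy.\<close>

fun lower_central :: "('a, 'b) monoid_scheme \<Rightarrow> nat \<Rightarrow> 'a set" where
  "lower_central G 0 = carrier G"
| "lower_central G (Suc 0) = carrier G"
| "lower_central G (Suc (Suc j)) = commutator_subgroup G (lower_central G (Suc j)) (carrier G)"

definition nilpotency_class :: "('a, 'b) monoid_scheme \<Rightarrow> nat" where
  "nilpotency_class G = (LEAST c. lower_central G (Suc c) = {\<one>\<^bsub>G\<^esub>})"

definition power_subgroup :: "('a, 'b) monoid_scheme \<Rightarrow> 'a set \<Rightarrow> nat \<Rightarrow> 'a set" where
  "power_subgroup G H p = generate G ((\<lambda>h. h [^]\<^bsub>G\<^esub> p) ` H)"

fun lower_exponent_central :: "nat \<Rightarrow> ('a, 'b) monoid_scheme \<Rightarrow> nat \<Rightarrow> 'a set" where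
  "lower_exponent_central p G 0 = carrier G"
| "lower_exponent_central p G (Suc j) =
     power_subgroup G (lower_exponent_central p G j) p
       <#>\<^bsub>G\<^esub> commutator_subgroup G (carrier G) (lower_exponent_central p G j)"

definition exponent_class :: "nat \<Rightarrow> ('a, 'b) monoid_scheme \<Rightarrow> nat" where
  "exponent_class p G = (LEAST c. lower_exponent_central p G c = {\<one>\<^bsub>G\<^esub>})"

definition derived_series :: "('a, 'b) monoid_scheme \<Rightarrow> nat \<Rightarrow> 'a set" where
  "derived_series G j = (derived G ^^ j) (carrier G)"

definition derived_length :: "('a, 'b) monoid_scheme \<Rightarrow> nat" where
  "derived_length G = (LEAST d. derived_series G d = {\<one>\<^bsub>G\<^esub>})"


section \<open>Descendant trees\<close>

definition finite_p_group :: "nat \<Rightarrow> ('a, 'b) monoid_scheme \<Rightarrow> bool" where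
  "finite_p_group p G \<longleftrightarrow> group G \<and> finite (carrier G) \<and> (\<exists>k. order G = p ^ k)"

datatype parent_kind = Lower_Central | Lower_Exponent_Central | Derived_Series

fun last_nontrivial :: "parent_kind \<Rightarrow> nat \<Rightarrow> ('a, 'b) monoid_scheme \<Rightarrow> 'a set" where
  "last_nontrivial Lower_Central p G = lower_central G (nilpotency_class G)"
| "last_nontrivial Lower_Exponent_Central p G =
     lower_exponent_central p G (exponent_class p G - 1)"
| "last_nontrivial Derived_Series p G = derived_series G (derived_length G - 1)"

text \<open>
  Vertices of a tree are isomorphism classes. They are represented by groups whose carriers
  lie in one fixed type \<open>'a\<close>; the parent of \<open>G\<close> is any group \<open>H\<close> over \<open>'a\<close> with a chosen
  identification \<open>f\<close> of \<open>G Mod N\<close> with \<open>H\<close>, and the projection is the coset map followed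
  by \<open>f\<close>. By the next lemma the fixed carrier type is no restriction. The trivial group has
  no last nontrivial term, hence no parent. The condition \<open>group H\<close> is not redundant:
  membership in \<open>iso\<close> does not determine the unit field of \<open>H\<close>.
\<close>

lemma quotient_representable:
  fixes G :: "'a monoid"
  assumes "N \<lhd> G"
  shows "\<exists>H :: 'a monoid. group H \<and> G Mod N \<cong> H"
proof -
  interpret normal N G by fact
  have Q: "group (G Mod N)" by (rule factorgroup_is_group)
  define r where "r X = (SOME x. x \<in> X)" for X :: "'a set"
  have r: "r X \<in> X" if "X \<in> carrier (G Mod N)" for X
    using rcosets_non_empty[of X] that
    by (auto simp: FactGroup_def r_def some_in_eq)
  have inj: "inj_on r (carrier (G Mod N))"
  proof (rule inj_onI)
    fix X Y assume XY: "X \<in> carrier (G Mod N)" "Y \<in> carrier (G Mod N)" "r X = r Y"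
    then have "r X \<in> X" "r X \<in> Y" using r by metis+
    then show "X = Y"
      using XY rcos_disjoint[OF subgroup_axioms] by (auto simp: FactGroup_def pairwise_def disjnt_def)
  qed
  define s where "s = inv_into (carrier (G Mod N)) r"
  have s: "s (r X) = X" if "X \<in> carrier (G Mod N)" for X
    using inj that by (simp add: s_def)
  define H where "H = \<lparr>carrier = r ` carrier (G Mod N),
    monoid.mult = (\<lambda>x y. r (s x \<otimes>\<^bsub>G Mod N\<^esub> s y)), one = r \<one>\<^bsub>G Mod N\<^esub>\<rparr>"
  have iso: "r \<in> iso (G Mod N) H"
    using inj group.is_monoid[OF Q]
    by (auto simp: iso_def hom_def H_def bij_betw_def s)
  have "group (H\<lparr>one := r \<one>\<^bsub>G Mod N\<^esub>\<rparr>)"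
    by (rule group.iso_imp_img_group[OF Q iso])
  then have "group H" by (simp add: H_def)
  with iso show ?thesis unfolding is_iso_def by blast
qed

definition parent_projection ::
  "parent_kind \<Rightarrow> nat \<Rightarrow> 'a monoid \<Rightarrow> ('a \<Rightarrow> 'a) \<Rightarrow> 'a monoid \<Rightarrow> bool" where
  "parent_projection kind p G \<pi> H \<longleftrightarrow>
     group H \<and> carrier G \<noteq> {\<one>\<^bsub>G\<^esub>} \<and>
     (\<exists>f \<in> iso (G Mod last_nontrivial kind p G) H.
        \<forall>x \<in> carrier G. \<pi> x = f (last_nontrivial kind p G #>\<^bsub>G\<^esub> x))"

text \<open>\<open>iterated_parent kind p n G \<phi> H\<close>: the group \<open>H\<close> is the \<open>n\<close>-th iterated parent of \<open>G\<close>
  and \<open>\<phi>\<close> is the compositum of the successive projections.\<close>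

inductive iterated_parent ::
  "parent_kind \<Rightarrow> nat \<Rightarrow> nat \<Rightarrow> 'a monoid \<Rightarrow> ('a \<Rightarrow> 'a) \<Rightarrow> 'a monoid \<Rightarrow> bool"
  for kind :: parent_kind and p :: nat where
  refl: "iterated_parent kind p 0 G id G"
| step: "iterated_parent kind p n G \<phi> H \<Longrightarrow> parent_projection kind p H \<pi> K \<Longrightarrow>
         iterated_parent kind p (Suc n) G (\<pi> \<circ> \<phi>) K"

definition descendant_tree :: "parent_kind \<Rightarrow> nat \<Rightarrow> 'a monoid \<Rightarrow> 'a monoid set" where
  "descendant_tree kind p R =
     {G. finite_p_group p G \<and> (\<exists>n \<phi> H. iterated_parent kind p n G \<phi> H \<and> H \<cong> R)}"

definition tree_object ::
  "parent_kind \<Rightarrow> nat \<Rightarrow> 'a monoid \<Rightarrow> 'i set \<Rightarrow> 'a monoid \<Rightarrow> ('i \<Rightarrow> 'a set) \<Rightarrow> bool" where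
  "tree_object kind p R I G U \<longleftrightarrow>
     G \<in> descendant_tree kind p R \<and> (\<forall>i\<in>I. subgroup (U i) G \<and> finite (lcosets\<^bsub>G\<^esub> U i))"

definition tree_morphism ::
  "parent_kind \<Rightarrow> nat \<Rightarrow> 'a monoid \<Rightarrow> 'i set \<Rightarrow> 'a monoid \<Rightarrow> ('i \<Rightarrow> 'a set) \<Rightarrow>
   ('a \<Rightarrow> 'a) \<Rightarrow> 'a monoid \<Rightarrow> ('i \<Rightarrow> 'a set) \<Rightarrow> bool" where
  "tree_morphism kind p R I G U \<phi> H V \<longleftrightarrow>
     tree_object kind p R I G U \<and> tree_object kind p R I H V \<and>
     (\<exists>n. iterated_parent kind p n G \<phi> H) \<and>
     (\<forall>i\<in>I. \<phi> ` U i = V i \<and> kernel G H \<phi> \<subseteq> U i)"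


section \<open>Artin patterns\<close>

definition abelianization :: "('a, 'b) monoid_scheme \<Rightarrow> 'a set \<Rightarrow> 'a set monoid" where
  "abelianization G U = (G\<lparr>carrier := U\<rparr>) Mod (derived G U)"

definition left_transversal :: "('a, 'b) monoid_scheme \<Rightarrow> 'a set \<Rightarrow> (nat \<Rightarrow> 'a) \<Rightarrow> bool" where
  "left_transversal G U l \<longleftrightarrow>
     l ` {1..card (lcosets\<^bsub>G\<^esub> U)} \<subseteq> carrier G \<and>
     bij_betw (\<lambda>i. l i <#\<^bsub>G\<^esub> U) {1..card (lcosets\<^bsub>G\<^esub> U)} (lcosets\<^bsub>G\<^esub> U)"

definition transversal_perm ::
  "('a, 'b) monoid_scheme \<Rightarrow> 'a set \<Rightarrow> (nat \<Rightarrow> 'a) \<Rightarrow> 'a \<Rightarrow> nat \<Rightarrow> nat" where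
  "transversal_perm G U l x i =
     (THE j. j \<in> {1..card (lcosets\<^bsub>G\<^esub> U)} \<and> (x \<otimes>\<^bsub>G\<^esub> l i) <#\<^bsub>G\<^esub> U = l j <#\<^bsub>G\<^esub> U)"

text \<open>The product is formed in the abelian group \<open>U/U'\<close>. Cosets of \<open>U'\<close> in \<open>U\<close> are written as
  right cosets, following the library; they are left cosets as well because \<open>U'\<close> is normal in \<open>U\<close>.\<close>

definition artin_transfer_wrt ::
  "('a, 'b) monoid_scheme \<Rightarrow> 'a set \<Rightarrow> (nat \<Rightarrow> 'a) \<Rightarrow> 'a \<Rightarrow> 'a set" where
  "artin_transfer_wrt G U l x =
     (\<Otimes>\<^bsub>abelianization G U\<^esub>i\<in>{1..card (lcosets\<^bsub>G\<^esub> U)}.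
        derived G U #>\<^bsub>G\<^esub> (inv\<^bsub>G\<^esub> (l (transversal_perm G U l x i)) \<otimes>\<^bsub>G\<^esub> x \<otimes>\<^bsub>G\<^esub> l i))"

text \<open>The transfer does not depend on the transversal, so an arbitrary one is chosen.\<close>

definition artin_transfer :: "('a, 'b) monoid_scheme \<Rightarrow> 'a set \<Rightarrow> 'a \<Rightarrow> 'a set" where
  "artin_transfer G U = artin_transfer_wrt G U (SOME l. left_transversal G U l)"

definition transfer_targets ::
  "('a, 'b) monoid_scheme \<Rightarrow> ('i \<Rightarrow> 'a set) \<Rightarrow> 'i \<Rightarrow> 'a set monoid" where
  "transfer_targets G U i = abelianization G (U i)"

definition transfer_kernels ::
  "('a, 'b) monoid_scheme \<Rightarrow> ('i \<Rightarrow> 'a set) \<Rightarrow> 'i \<Rightarrow> 'a set" where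
  "transfer_kernels G U i = kernel G (abelianization G (U i)) (artin_transfer G (U i))"

definition induced_map ::
  "('c, 'd) monoid_scheme \<Rightarrow> ('a \<Rightarrow> 'c) \<Rightarrow> 'c set \<Rightarrow> 'a set \<Rightarrow> 'c set" where
  "induced_map H \<phi> V X = the_elem ((\<lambda>x. derived H V #>\<^bsub>H\<^esub> \<phi> x) ` X)"

text \<open>Both orders are relative to an epimorphism \<open>\<phi>\<close> from \<open>G\<close> to \<open>H\<close> that maps \<open>U i\<close> onto
  \<open>V i\<close> and whose kernel is contained in \<open>U i\<close>, for all \<open>i\<close> in \<open>I\<close>.\<close>

definition targets_le ::
  "'i set \<Rightarrow> ('a \<Rightarrow> 'c) \<Rightarrow> ('c, 'd) monoid_scheme \<Rightarrow> ('i \<Rightarrow> 'c set) \<Rightarrow>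
   ('a, 'b) monoid_scheme \<Rightarrow> ('i \<Rightarrow> 'a set) \<Rightarrow> bool" where
  "targets_le I \<phi> H V G U \<longleftrightarrow>
     (\<forall>i\<in>I. transfer_targets H V i \<cong>
        transfer_targets G U i Mod
          kernel (transfer_targets G U i) (transfer_targets H V i) (induced_map H \<phi> (V i)))"

definition kernels_le ::
  "'i set \<Rightarrow> ('a \<Rightarrow> 'c) \<Rightarrow> ('a, 'b) monoid_scheme \<Rightarrow> ('i \<Rightarrow> 'a set) \<Rightarrow>
   ('c, 'd) monoid_scheme \<Rightarrow> ('i \<Rightarrow> 'c set) \<Rightarrow> bool" where
  "kernels_le I \<phi> G U H V \<longleftrightarrow>
     (\<forall>i\<in>I. \<phi> ` transfer_kernels G U i \<subseteq> transfer_kernels H V i)"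

end

theory Submission
  imports Defs "HOL-Algebra.SndIsomorphismGrp"
begin

text \<open>
  Two independent facts combine.

  The first concerns kernels. The three kinds of parent divide by a term of one of three
  descending series of normal subgroups, each starting with the whole group and each carried by
  epimorphisms onto the corresponding series of the image. If a parent \<open>\<pi>(H)\<close> is nontrivial,
  the term divided out is not \<open>H\<close>, so it lies in the second member of the series
  (\<open>last_nontrivial_subset\<close>). That member of \<open>H = \<pi>\<^sup>n(G)\<close> is the image of the second member of
  \<open>G\<close>, so by induction along the path the kernel of \<open>\<pi>\<^sup>n\<close> stays inside the second member of
  \<open>G\<close> (\<open>iterated_parent_epi\<close>). The hypothesis that every \<open>U\<^sub>i\<close> contains this member therefore
  gives \<open>ker(\<pi>\<^sup>n) \<le> U\<^sub>i\<close>. The nontriviality needed at each step comes from the nontrivial root,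
  onto an isomorphic copy of which every vertex projects.

  The second concerns any epimorphism \<open>\<phi>: G \<rightarrow> H\<close> with \<open>ker(\<phi>) \<le> U\<close>; put \<open>V = \<phi>(U)\<close>. Since
  \<open>\<phi>(U') = V'\<close>, there is an induced epimorphism \<open>U/U' \<rightarrow> V/V'\<close>, and the first isomorphism
  theorem compares the targets. Since \<open>U\<close> is the full preimage of \<open>V\<close>, the map \<open>\<phi>\<close> carries a left
  transversal of \<open>U\<close> to one of \<open>V\<close> with the same permutations, so the induced map carries each
  factor of the transfer product of \<open>x\<close> to the factor of \<open>\<phi>(x)\<close>. As the transfer does not depend
  on the transversal (\<open>artin_transfer_wrt_unique\<close>), the square formed by \<open>T\<close> and \<open>\<phi>\<close> commutes
  (\<open>artin_transfer_img\<close>), and \<open>\<phi>\<close> maps one transfer kernel into the other.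
\<close>

section \<open>Descending series and epimorphisms\<close>

text \<open>The three series on a common scale: index 0 is the whole group and index 1 is the subgroup
  that the members of the family have to contain. The lower central series starts at 1, hence the
  shift.\<close>
definition descending_series ::
  "parent_kind \<Rightarrow> nat \<Rightarrow> ('a, 'b) monoid_scheme \<Rightarrow> nat \<Rightarrow> 'a set" where
  "descending_series kind p G j = (case kind of
     Lower_Central \<Rightarrow> lower_central G (Suc j)
   | Lower_Exponent_Central \<Rightarrow> lower_exponent_central p G j
   | Derived_Series \<Rightarrow> derived_series G j)"

lemma (in group) group_hom_conjugation:
  assumes "g \<in> carrier G"
  shows "group_hom G G (\<lambda>x. g \<otimes> x \<otimes> inv g)"
proof (unfold_locales, rule homI)
  show "g \<otimes> x \<otimes> inv g \<in> carrier G" if "x \<in> carrier G" for x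
    using assms that by simp
  fix x y assume "x \<in> carrier G" "y \<in> carrier G"
  then show "g \<otimes> (x \<otimes> y) \<otimes> inv g = (g \<otimes> x \<otimes> inv g) \<otimes> (g \<otimes> y \<otimes> inv g)"
    using assms by (simp add: m_assoc inv_solve_left)
qed

lemma (in group) conjugation_img_normal:
  assumes "N \<lhd> G" and g: "g \<in> carrier G"
  shows "(\<lambda>x. g \<otimes> x \<otimes> inv g) ` N = N"
proof
  interpret normal N G by fact
  show "(\<lambda>x. g \<otimes> x \<otimes> inv g) ` N \<subseteq> N"
    using inv_op_closed2 g by auto
  show "N \<subseteq> (\<lambda>x. g \<otimes> x \<otimes> inv g) ` N"
  proof
    fix x assume x: "x \<in> N"
    have "g \<otimes> (inv g \<otimes> x \<otimes> g) \<otimes> inv g = x"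
      using g x by (simp add: m_assoc inv_solve_left) (simp add: m_assoc[symmetric])
    with inv_op_closed1[OF g x] show "x \<in> (\<lambda>x. g \<otimes> x \<otimes> inv g) ` N"
      by (metis image_eqI)
  qed
qed

lemma (in group) normal_if_conjugation_img:
  assumes "subgroup N G"
    and "\<And>g. g \<in> carrier G \<Longrightarrow> (\<lambda>x. g \<otimes> x \<otimes> inv g) ` N = N"
  shows "N \<lhd> G"
  using assms by (intro normal_invI) auto

lemma (in group) commutators_in_carrier:
  assumes "A \<subseteq> carrier G" "B \<subseteq> carrier G"
  shows "(\<Union>h\<in>A. \<Union>k\<in>B. {h \<otimes> k \<otimes> inv h \<otimes> inv k}) \<subseteq> carrier G"
  using assms by (auto simp: subset_iff)

lemma (in group) subgroup_commutator_subgroup: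
  assumes "A \<subseteq> carrier G" "B \<subseteq> carrier G"
  shows "subgroup (commutator_subgroup G A B) G"
  unfolding commutator_subgroup_def
  by (rule generate_is_subgroup[OF commutators_in_carrier[OF assms]])

lemma (in group) subgroup_power_subgroup:
  assumes "A \<subseteq> carrier G"
  shows "subgroup (power_subgroup G A p) G"
  unfolding power_subgroup_def
  by (rule generate_is_subgroup) (use assms in auto)

lemma (in group_hom) commutator_subgroup_img:
  assumes A: "A \<subseteq> carrier G" and B: "B \<subseteq> carrier G"
  shows "commutator_subgroup H (h ` A) (h ` B) = h ` commutator_subgroup G A B"
proof -
  have eq: "h (x \<otimes> y \<otimes> inv x \<otimes> inv y)
      = h x \<otimes>\<^bsub>H\<^esub> h y \<otimes>\<^bsub>H\<^esub> inv\<^bsub>H\<^esub> h x \<otimes>\<^bsub>H\<^esub> inv\<^bsub>H\<^esub> h y"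
    if "x \<in> A" "y \<in> B" for x y
    using that A B by (simp add: subset_iff)
  have "(\<Union>x\<in>h ` A. \<Union>y\<in>h ` B. {x \<otimes>\<^bsub>H\<^esub> y \<otimes>\<^bsub>H\<^esub> inv\<^bsub>H\<^esub> x \<otimes>\<^bsub>H\<^esub> inv\<^bsub>H\<^esub> y})
      = (\<Union>x\<in>A. \<Union>y\<in>B. {h (x \<otimes> y \<otimes> inv x \<otimes> inv y)})"
    using eq by simp
  also have "\<dots> = h ` (\<Union>x\<in>A. \<Union>y\<in>B. {x \<otimes> y \<otimes> inv x \<otimes> inv y})"
    by (simp add: image_UN)
  finally show ?thesis
    unfolding commutator_subgroup_def
    by (simp add: generate_img G.commutators_in_carrier[OF A B])
qed

lemma (in group_hom) power_subgroup_img: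
  assumes "A \<subseteq> carrier G"
  shows "power_subgroup H (h ` A) p = h ` power_subgroup G A p"
proof -
  have "(\<lambda>x. x [^]\<^bsub>H\<^esub> p) ` h ` A = h ` (\<lambda>x. x [^] p) ` A"
    using assms by (force simp: image_image subset_iff hom_nat_pow intro!: image_cong)
  moreover have "(\<lambda>x. x [^] p) ` A \<subseteq> carrier G"
    using assms by auto
  ultimately show ?thesis
    by (simp only: power_subgroup_def generate_img)
qed

text \<open>Conjugations are homomorphisms, so they can be moved past the formation of commutators and
  powers, where they fix the normal arguments. This reduces normality to the image lemmas above and
  avoids conjugating products by hand.\<close>
lemma (in group) normal_commutator_subgroup:
  assumes "A \<lhd> G" "B \<lhd> G"
  shows "commutator_subgroup G A B \<lhd> G"
proof (rule normal_if_conjugation_img)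
  have AB: "A \<subseteq> carrier G" "B \<subseteq> carrier G"
    using assms by (auto dest: normal_imp_subgroup subgroup.subset)
  then show "subgroup (commutator_subgroup G A B) G" by (rule subgroup_commutator_subgroup)
  fix g assume g: "g \<in> carrier G"
  show "(\<lambda>x. g \<otimes> x \<otimes> inv g) ` commutator_subgroup G A B = commutator_subgroup G A B"
    using group_hom.commutator_subgroup_img[OF group_hom_conjugation[OF g] AB]
    by (simp add: conjugation_img_normal assms g)
qed

lemma (in group) normal_power_subgroup:
  assumes "A \<lhd> G"
  shows "power_subgroup G A p \<lhd> G"
proof (rule normal_if_conjugation_img)
  have A: "A \<subseteq> carrier G"
    using assms by (auto dest: normal_imp_subgroup subgroup.subset)
  then show "subgroup (power_subgroup G A p) G" by (rule subgroup_power_subgroup)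
  fix g assume g: "g \<in> carrier G"
  show "(\<lambda>x. g \<otimes> x \<otimes> inv g) ` power_subgroup G A p = power_subgroup G A p"
    using group_hom.power_subgroup_img[OF group_hom_conjugation[OF g] A]
    by (simp add: conjugation_img_normal assms g)
qed

lemma (in group) commutator_subgroup_subset:
  assumes "N \<lhd> G"
  shows "commutator_subgroup G N (carrier G) \<subseteq> N"
    and "commutator_subgroup G (carrier G) N \<subseteq> N"
proof -
  interpret normal N G by fact
  have "h \<otimes> k \<otimes> inv h \<otimes> inv k \<in> N" if "h \<in> N" "k \<in> carrier G" for h k
    using that inv_op_closed2[of k "inv h"] by (simp add: m_assoc)
  then show "commutator_subgroup G N (carrier G) \<subseteq> N"
    unfolding commutator_subgroup_def by (intro generate_subgroup_incl subgroup_axioms) auto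
  have "h \<otimes> k \<otimes> inv h \<otimes> inv k \<in> N" if "h \<in> carrier G" "k \<in> N" for h k
    using that inv_op_closed2[of h k] by simp
  then show "commutator_subgroup G (carrier G) N \<subseteq> N"
    unfolding commutator_subgroup_def by (intro generate_subgroup_incl subgroup_axioms) auto
qed

lemma (in group) power_subgroup_subset:
  assumes "subgroup N G"
  shows "power_subgroup G N p \<subseteq> N"
proof -
  interpret subgroup N G by fact
  have "h [^] p \<in> N" if "h \<in> N" for h
    using that by (induction p) auto
  then show ?thesis
    unfolding power_subgroup_def by (intro generate_subgroup_incl assms) auto
qed

lemma descending_series_0 [simp]: "descending_series kind p G 0 = carrier G"
  by (cases kind) (simp_all add: descending_series_def derived_series_def)

lemma descending_series_Suc:
  "descending_series kind p G (Suc j) = (let N = descending_series kind p G j in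
     case kind of
       Lower_Central \<Rightarrow> commutator_subgroup G N (carrier G)
     | Lower_Exponent_Central \<Rightarrow>
         power_subgroup G N p <#>\<^bsub>G\<^esub> commutator_subgroup G (carrier G) N
     | Derived_Series \<Rightarrow> derived G N)"
  by (cases kind) (simp_all add: descending_series_def derived_series_def Let_def)

lemma (in group) normal_descending_series: "descending_series kind p G j \<lhd> G"
proof (induction j)
  case 0
  show ?case by (simp add: normal_self)
next
  case (Suc j)
  then show ?case
    unfolding descending_series_Suc Let_def
    by (cases kind)
       (simp_all only: parent_kind.case, (intro derived_is_normal normal_commutator_subgroup
          normal_power_subgroup normal_subgroup_set_mult_closed normal_self; assumption)+)
qed

lemma (in group) descending_series_subset_carrier: "descending_series kind p G j \<subseteq> carrier G"
  using normal_descending_series normal_imp_subgroup subgroup.subset by metis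

lemma (in group) descending_series_antimono:
  "descending_series kind p G (Suc j) \<subseteq> descending_series kind p G j"
proof -
  let ?N = "descending_series kind p G j"
  have N: "?N \<lhd> G" by (rule normal_descending_series)
  interpret N: normal ?N G by (rule N)
  have "power_subgroup G ?N p <#> commutator_subgroup G (carrier G) ?N \<subseteq> ?N"
    using power_subgroup_subset[OF N.subgroup_axioms, of p] commutator_subgroup_subset(2)[OF N]
    by (auto simp: set_mult_def)
  then show ?thesis
    using commutator_subgroup_subset(1)[OF N] derived_incl[OF subset_refl N.subgroup_axioms]
    by (cases kind) (simp_all add: descending_series_Suc Let_def)
qed

lemma (in group) descending_series_subset_1:
  assumes "j > 0"
  shows "descending_series kind p G j \<subseteq> descending_series kind p G 1"
  using lift_Suc_antimono_le[of "descending_series kind p G" 1 j] descending_series_antimono assms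
  by simp

text \<open>Each member is built from the preceding one and the whole group by commutators and powers, and
  a homomorphism respects these. Surjectivity identifies the image of the whole group.\<close>
lemma (in group_hom) descending_series_img:
  assumes surj: "h ` carrier G = carrier H"
  shows "h ` descending_series kind p G j = descending_series kind p H j"
proof (induction j)
  case 0
  show ?case by (simp add: surj)
next
  case (Suc j)
  let ?N = "\<lambda>k. descending_series k p G j"
  have N: "?N k \<subseteq> carrier G" for k by (rule G.descending_series_subset_carrier)
  have comm: "commutator_subgroup G (carrier G) (?N k) \<subseteq> carrier G" for k
    by (rule subgroup.subset[OF G.subgroup_commutator_subgroup[OF subset_refl N]])
  have pow: "power_subgroup G (?N k) p \<subseteq> carrier G" for k
    by (rule subgroup.subset[OF G.subgroup_power_subgroup[OF N]])
  show ?case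
    unfolding descending_series_Suc Let_def Suc.IH[symmetric] surj[symmetric]
    by (cases kind)
       (simp_all only: parent_kind.case derived_img[OF N] power_subgroup_img[OF N]
          commutator_subgroup_img[OF N subset_refl] commutator_subgroup_img[OF subset_refl N]
          set_mult_hom[OF homh pow comm])
qed

text \<open>Index 0 also covers the trivial group: its class, exponent class and derived length are 0, and
  the dummy or truncated index then selects the whole group.\<close>
lemma last_nontrivial_descending_series:
  "\<exists>j. last_nontrivial kind p G = descending_series kind p G j"
proof (cases kind)
  case Lower_Central
  show ?thesis
  proof (cases "nilpotency_class G")
    case 0
    then have "last_nontrivial kind p G = descending_series kind p G 0"
      using Lower_Central by simp
    then show ?thesis ..
  next
    case (Suc j)
    then have "last_nontrivial kind p G = descending_series kind p G j"
      using Lower_Central by (simp add: descending_series_def)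
    then show ?thesis ..
  qed
qed (auto simp: descending_series_def)

lemma (in group) normal_last_nontrivial: "last_nontrivial kind p G \<lhd> G"
  using last_nontrivial_descending_series[of kind p G] normal_descending_series by metis

text \<open>At index 0 of its series the term would be the whole group.\<close>
lemma (in group) last_nontrivial_subset:
  assumes "last_nontrivial kind p G \<noteq> carrier G"
  shows "last_nontrivial kind p G \<subseteq> descending_series kind p G 1"
proof -
  obtain j where j: "last_nontrivial kind p G = descending_series kind p G j"
    using last_nontrivial_descending_series by metis
  with assms have "j > 0" by (cases j) auto
  then show ?thesis using descending_series_subset_1 j by simp
qed


section \<open>Kernels of projections in the tree\<close>

text \<open>A parent projection is a coset map followed by an isomorphism, so it is an epimorphism, and its
  kernel is the subgroup that is divided out.\<close>
lemma parent_projection_epi: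
  assumes "group G" and proj: "parent_projection kind p G \<pi> H"
  shows "group_hom G H \<pi>" and "\<pi> ` carrier G = carrier H"
    and "kernel G H \<pi> = last_nontrivial kind p G"
proof -
  interpret group G by fact
  let ?N = "last_nontrivial kind p G"
  interpret N: normal ?N G by (rule normal_last_nontrivial)
  interpret Q: group "G Mod ?N" by (rule N.factorgroup_is_group)
  obtain f where H: "group H" and f: "f \<in> iso (G Mod ?N) H"
    and \<pi>: "\<And>x. x \<in> carrier G \<Longrightarrow> \<pi> x = f (?N #>\<^bsub>G\<^esub> x)"
    using proj unfolding parent_projection_def by blast
  interpret H: group H by fact
  have fhom: "f \<in> hom (G Mod ?N) H" and fbij: "bij_betw f (carrier (G Mod ?N)) (carrier H)"
    using f by (auto simp: iso_def)
  interpret f: group_hom "G Mod ?N" H f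
    using fhom by unfold_locales
  have "(\<lambda>x. f (?N #>\<^bsub>G\<^esub> x)) \<in> hom G H"
    using Group.hom_compose[OF N.r_coset_hom_Mod fhom] by (simp add: comp_def)
  then have "\<pi> \<in> hom G H"
    by (auto simp: hom_def \<pi>)
  then show "group_hom G H \<pi>"
    by unfold_locales
  have "\<pi> ` carrier G = f ` (\<lambda>x. ?N #>\<^bsub>G\<^esub> x) ` carrier G"
    by (auto simp: \<pi> image_image)
  also have "(\<lambda>x. ?N #>\<^bsub>G\<^esub> x) ` carrier G = carrier (G Mod ?N)"
    by (auto simp: FactGroup_def RCOSETS_def)
  finally show "\<pi> ` carrier G = carrier H"
    using fbij by (simp add: bij_betw_def)
  have "\<pi> x = \<one>\<^bsub>H\<^esub> \<longleftrightarrow> x \<in> ?N" if x: "x \<in> carrier G" for x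
  proof -
    have "?N #>\<^bsub>G\<^esub> x \<in> carrier (G Mod ?N)"
      using x by (auto simp: FactGroup_def RCOSETS_def)
    then have "\<pi> x = \<one>\<^bsub>H\<^esub> \<longleftrightarrow> ?N #>\<^bsub>G\<^esub> x = \<one>\<^bsub>G Mod ?N\<^esub>"
      using fbij f.hom_one Q.one_closed \<pi>[OF x] by (metis bij_betw_def inj_on_eq_iff)
    also have "\<dots> \<longleftrightarrow> x \<in> ?N"
      using x by (simp add: FactGroup_def) (metis coset_join1 coset_join2 N.subgroup_axioms N.subset)
    finally show ?thesis .
  qed
  then show "kernel G H \<pi> = ?N"
    using N.subset by (auto simp: kernel_def)
qed

text \<open>At each step the kernel of the projection lies in the term at index 1 of the
  series of the current vertex. That term is the image of the corresponding term of \<open>G\<close>, which therefore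
  also contains the kernel of the composite. Nontriviality of the end vertex passes up the path
  and keeps every step away from the case of a projection onto the trivial group.\<close>
lemma iterated_parent_epi:
  assumes "iterated_parent kind p n G \<phi> H" and G: "group G"
  shows "group_hom G H \<phi>" and "\<phi> ` carrier G = carrier H"
    and "carrier H \<noteq> {\<one>\<^bsub>H\<^esub>} \<Longrightarrow> kernel G H \<phi> \<subseteq> descending_series kind p G 1"
  using assms
proof (induction rule: iterated_parent.induct)
  case (refl G)
  {
    case 1
    then interpret group G .
    show ?case by unfold_locales (auto simp: hom_def)
  next
    case 2
    show ?case by simp
  next
    case 3
    then interpret group G by simp
    show ?case
      using subgroup.one_closed[OF normal_imp_subgroup[OF normal_descending_series]]
      by (auto simp: kernel_def)
  }
next
  case (step n G \<phi> H \<pi> K)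
  {
    case 1
    interpret \<phi>: group_hom G H \<phi> by (rule step.IH(1)[OF 1])
    interpret \<pi>: group_hom H K \<pi> by (rule parent_projection_epi[OF \<phi>.H.is_group step.hyps(2)])
    show ?case
      by unfold_locales (rule hom_compose[OF \<phi>.homh \<pi>.homh])
  next
    case 2
    interpret \<phi>: group_hom G H \<phi> by (rule step.IH(1)[OF 2])
    show ?case
      using step.IH(2)[OF 2] parent_projection_epi(2)[OF \<phi>.H.is_group step.hyps(2)]
      by (metis image_comp)
  next
    case 3
    interpret \<phi>: group_hom G H \<phi> by (rule step.IH(1)[OF 3(2)])
    interpret \<pi>: group_hom H K \<pi> by (rule parent_projection_epi[OF \<phi>.H.is_group step.hyps(2)])
    note surj = step.IH(2)[OF 3(2)]
    note \<pi>surj = parent_projection_epi(2)[OF \<phi>.H.is_group step.hyps(2)]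
    note \<pi>ker = parent_projection_epi(3)[OF \<phi>.H.is_group step.hyps(2)]
    \<comment> \<open>otherwise \<open>K\<close> would be trivial\<close>
    have "last_nontrivial kind p H \<noteq> carrier H"
      using 3(1) \<pi>surj unfolding \<pi>ker[symmetric] \<pi>.trivial_hom_iff[symmetric] by simp
    then have ker\<pi>: "kernel H K \<pi> \<subseteq> \<phi> ` descending_series kind p G 1"
      unfolding \<pi>ker \<phi>.descending_series_img[OF surj] by (rule \<phi>.H.last_nontrivial_subset)
    have "carrier H \<noteq> {\<one>\<^bsub>H\<^esub>}"
      using 3(1) \<pi>surj by force
    then have ker\<phi>: "kernel G H \<phi> \<subseteq> descending_series kind p G 1"
      using step.IH(3) 3(2) by simp
    interpret S: subgroup "descending_series kind p G 1" G
      by (rule normal_imp_subgroup[OF \<phi>.G.normal_descending_series])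
    show ?case
    proof
      \<comment> \<open>Lift \<open>\<phi> x\<close> to some \<open>s\<close> in the term of \<open>G\<close>; then \<open>x\<close> and \<open>s\<close> differ by an element of
        the kernel of \<open>\<phi>\<close>, which lies in the term as well.\<close>
      fix x assume "x \<in> kernel G K (\<pi> \<circ> \<phi>)"
      then have x: "x \<in> carrier G" "\<phi> x \<in> kernel H K \<pi>"
        by (auto simp: kernel_def)
      then obtain s where s: "s \<in> descending_series kind p G 1" "\<phi> x = \<phi> s"
        using ker\<pi> by blast
      then have "x \<otimes>\<^bsub>G\<^esub> inv\<^bsub>G\<^esub> s \<in> kernel G H \<phi>"
        using x by (simp add: kernel_def)
      then have "x \<otimes>\<^bsub>G\<^esub> inv\<^bsub>G\<^esub> s \<otimes>\<^bsub>G\<^esub> s \<in> descending_series kind p G 1"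
        using ker\<phi> s by blast
      then show "x \<in> descending_series kind p G 1"
        using x s by (simp add: \<phi>.G.m_assoc)
    qed
  }
qed

text \<open>Every vertex maps onto a copy of the root, by a composite of epimorphisms.\<close>
lemma descendant_nontrivial:
  assumes G: "G \<in> descendant_tree kind p R" and R: "carrier R \<noteq> {\<one>\<^bsub>R\<^esub>}" "group R"
  shows "carrier G \<noteq> {\<one>\<^bsub>G\<^esub>}"
proof
  assume triv: "carrier G = {\<one>\<^bsub>G\<^esub>}"
  obtain n \<phi> K where it: "iterated_parent kind p n G \<phi> K" and K: "K \<cong> R" and grp: "group G"
    using G by (auto simp: descendant_tree_def finite_p_group_def)
  interpret \<phi>: group_hom G K \<phi> by (rule iterated_parent_epi(1)[OF it grp])
  obtain f where f: "f \<in> iso K R" using K by (auto simp: is_iso_def)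
  interpret f: group_hom K R f
    using f R(2) \<phi>.H.is_group by (simp add: group_hom_def group_hom_axioms_def iso_def)
  have "carrier K = {\<one>\<^bsub>K\<^esub>}"
    using iterated_parent_epi(2)[OF it grp] triv by auto
  moreover have "carrier R = f ` carrier K"
    using f by (auto simp: iso_def bij_betw_def)
  ultimately show False using R by simp
qed


section \<open>Abelianizations and induced maps\<close>

lemma (in group) abelianization_comm_group:
  assumes "subgroup U G"
  shows "comm_group (abelianization G U)"
  unfolding abelianization_def by (rule derived_quot_of_subgroup_is_comm_group[OF assms])

lemma (in group) abelianization_hom:
  assumes "subgroup U G"
  shows "(\<lambda>u. derived G U #> u) \<in> hom (G\<lparr>carrier := U\<rparr>) (abelianization G U)"
proof -
  have "derived G U #>\<^bsub>G\<lparr>carrier := U\<rparr>\<^esub> u = derived G U #> u" for u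
    by (simp add: r_coset_def)
  with normal.r_coset_hom_Mod[OF derived_subgroup_is_normal[OF assms]]
  show ?thesis by (simp add: abelianization_def)
qed

lemma carrier_abelianization:
  "carrier (abelianization G U) = (\<lambda>u. derived G U #>\<^bsub>G\<^esub> u) ` U"
  by (auto simp: abelianization_def FactGroup_def RCOSETS_def r_coset_def)

text \<open>The induced map takes the single element of a set indexed by the members of a coset. That set
  is a singleton because \<open>h\<close> maps \<open>U'\<close> onto \<open>(h U)'\<close>, which absorbs the choice of the member.\<close>
lemma (in group_hom) induced_map_coset:
  assumes U: "subgroup U G" and u: "u \<in> U"
  shows "induced_map H h (h ` U) (derived G U #> u) = derived H (h ` U) #>\<^bsub>H\<^esub> h u"
proof -
  have U_car: "U \<subseteq> carrier G" by (rule subgroup.subset[OF U])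
  have D: "derived H (h ` U) = h ` derived G U"
    by (rule derived_img[OF U_car])
  have DU: "derived G U \<subseteq> carrier G"
    by (rule G.derived_in_carrier[OF U_car])
  have sub: "subgroup (derived H (h ` U)) H"
    by (rule H.derived_is_subgroup) (use U_car in auto)
  have const: "derived H (h ` U) #>\<^bsub>H\<^esub> h x = derived H (h ` U) #>\<^bsub>H\<^esub> h u"
    if x: "x \<in> derived G U #> u" for x
  proof -
    obtain d where d: "d \<in> derived G U" "x = d \<otimes> u"
      using x by (auto simp: r_coset_def)
    have "h x \<in> derived H (h ` U) #>\<^bsub>H\<^esub> h u"
      unfolding D r_coset_def using d DU u U_car by (auto simp: subset_iff)
    then show ?thesis
      using H.repr_independence[OF _ _ sub] u U_car by auto
  qed
  have "u \<in> derived G U #> u"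
    using G.rcos_self[OF _ G.derived_is_subgroup[OF U_car]] u U_car by auto
  then have "(\<lambda>x. derived H (h ` U) #>\<^bsub>H\<^esub> h x) ` (derived G U #> u)
      = {derived H (h ` U) #>\<^bsub>H\<^esub> h u}"
    using const by blast
  then show ?thesis by (simp add: induced_map_def)
qed

lemma (in group_hom) induced_map_epi:
  assumes U: "subgroup U G"
  shows "group_hom (abelianization G U) (abelianization H (h ` U)) (induced_map H h (h ` U))"
    and "induced_map H h (h ` U) ` carrier (abelianization G U)
      = carrier (abelianization H (h ` U))"
proof -
  let ?A = "abelianization G U" and ?B = "abelianization H (h ` U)"
    and ?f = "induced_map H h (h ` U)"
  have V: "subgroup (h ` U) H" by (rule subgroup_img_is_subgroup[OF U])
  have U_car: "U \<subseteq> carrier G" by (rule subgroup.subset[OF U])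
  interpret A: comm_group ?A by (rule G.abelianization_comm_group[OF U])
  interpret B: comm_group ?B by (rule H.abelianization_comm_group[OF V])
  have multA: "derived G U #> (a \<otimes> b) = (derived G U #> a) \<otimes>\<^bsub>?A\<^esub> (derived G U #> b)"
    if "a \<in> U" "b \<in> U" for a b
    using Group.hom_mult[OF G.abelianization_hom[OF U]] that by simp
  have multB: "derived H (h ` U) #>\<^bsub>H\<^esub> (h a \<otimes>\<^bsub>H\<^esub> h b)
      = (derived H (h ` U) #>\<^bsub>H\<^esub> h a) \<otimes>\<^bsub>?B\<^esub> (derived H (h ` U) #>\<^bsub>H\<^esub> h b)"
    if "a \<in> U" "b \<in> U" for a b
    using Group.hom_mult[OF H.abelianization_hom[OF V]] that by simp
  have "?f \<in> hom ?A ?B"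
  proof (rule homI)
    show "?f X \<in> carrier ?B" if "X \<in> carrier ?A" for X
      using that by (auto simp: carrier_abelianization induced_map_coset[OF U])
    fix X Y assume "X \<in> carrier ?A" "Y \<in> carrier ?A"
    then obtain a b where ab: "a \<in> U" "b \<in> U"
      and XY: "X = derived G U #> a" "Y = derived G U #> b"
      by (auto simp: carrier_abelianization)
    have "a \<otimes> b \<in> U" using ab subgroup.m_closed[OF U] by simp
    then have "?f (X \<otimes>\<^bsub>?A\<^esub> Y) = derived H (h ` U) #>\<^bsub>H\<^esub> h (a \<otimes> b)"
      by (simp add: XY multA[OF ab, symmetric] induced_map_coset[OF U])
    also have "h (a \<otimes> b) = h a \<otimes>\<^bsub>H\<^esub> h b"
      using ab U_car by (simp add: subset_iff)
    also have "derived H (h ` U) #>\<^bsub>H\<^esub> \<dots> = ?f X \<otimes>\<^bsub>?B\<^esub> ?f Y"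
      by (simp add: multB[OF ab] XY induced_map_coset[OF U] ab)
    finally show "?f (X \<otimes>\<^bsub>?A\<^esub> Y) = ?f X \<otimes>\<^bsub>?B\<^esub> ?f Y" .
  qed
  then show "group_hom ?A ?B ?f" by unfold_locales
  show "?f ` carrier ?A = carrier ?B"
    by (auto simp: carrier_abelianization image_image induced_map_coset[OF U])
qed


section \<open>The Artin transfer under a change of transversal and under epimorphisms\<close>

lemma (in group) l_coset_eq_iff:
  assumes U: "subgroup U G" and x: "x \<in> carrier G" and y: "y \<in> carrier G"
  shows "x <# U = y <# U \<longleftrightarrow> inv x \<otimes> y \<in> U"
proof
  assume "x <# U = y <# U"
  then have "y \<in> x <# U" using lcos_self[OF y U] by simp
  then show "inv x \<otimes> y \<in> U" by (rule subgroup.lcos_module_imp[OF U is_group x])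
next
  assume "inv x \<otimes> y \<in> U"
  then have "y \<in> x <# U" by (rule subgroup.lcos_module_rev[OF U is_group x y])
  then show "x <# U = y <# U" by (rule l_repr_independence[OF _ x U])
qed

lemma (in group) left_transversal_exists:
  assumes fin: "finite (lcosets U)"
  shows "\<exists>l. left_transversal G U l"
proof -
  obtain b where b: "bij_betw b {1..card (lcosets U)} (lcosets U)"
    using ex_bij_betw_nat_finite_1[OF fin] by blast
  have "\<exists>a. a \<in> carrier G \<and> a <# U = b i" if "i \<in> {1..card (lcosets U)}" for i
    using bij_betwE[OF b] that unfolding LCOSETS_def by blast
  then obtain l where l: "\<And>i. i \<in> {1..card (lcosets U)} \<Longrightarrow> l i \<in> carrier G \<and> l i <# U = b i"
    by metis
  have "bij_betw (\<lambda>i. l i <# U) {1..card (lcosets U)} (lcosets U)"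
    using b by (subst bij_betw_cong[where g = b]) (use l in auto)
  then show ?thesis using l unfolding left_transversal_def by blast
qed

lemma (in group) artin_transfer_eq_wrt_some:
  assumes "finite (lcosets U)"
  obtains l where "left_transversal G U l" "artin_transfer G U = artin_transfer_wrt G U l"
  using someI_ex[OF left_transversal_exists[OF assms]] by (auto simp: artin_transfer_def)

lemma (in group) left_transversal_carrier:
  "left_transversal G U l \<Longrightarrow> i \<in> {1..card (lcosets U)} \<Longrightarrow> l i \<in> carrier G"
  by (auto simp: left_transversal_def)

lemma (in group) left_transversal_inj:
  assumes "left_transversal G U l" "i \<in> {1..card (lcosets U)}" "j \<in> {1..card (lcosets U)}"
    and "l i <# U = l j <# U"
  shows "i = j"
proof -
  have "inj_on (\<lambda>i. l i <# U) {1..card (lcosets U)}"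
    using assms(1) by (simp add: left_transversal_def bij_betw_def)
  then show ?thesis using assms(4,2,3) by (rule inj_onD)
qed

lemma (in group) transversal_perm:
  assumes l: "left_transversal G U l" and x: "x \<in> carrier G" and i: "i \<in> {1..card (lcosets U)}"
  shows "transversal_perm G U l x i \<in> {1..card (lcosets U)}"
    and "(x \<otimes> l i) <# U = l (transversal_perm G U l x i) <# U"
proof -
  let ?P = "\<lambda>j. j \<in> {1..card (lcosets U)} \<and> (x \<otimes> l i) <# U = l j <# U"
  have "(x \<otimes> l i) <# U \<in> lcosets U"
    unfolding LCOSETS_def using m_closed[OF x left_transversal_carrier[OF l i]] by blast
  then have "(x \<otimes> l i) <# U \<in> (\<lambda>j. l j <# U) ` {1..card (lcosets U)}"
    using l by (simp add: left_transversal_def bij_betw_def)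
  then obtain j where "(x \<otimes> l i) <# U = l j <# U" "j \<in> {1..card (lcosets U)}"
    by (rule imageE)
  then have j: "?P j" by blast
  have "\<exists>!j. ?P j"
  proof (rule ex1I[of ?P, OF j])
    fix k assume k: "?P k"
    show "k = j"
      by (rule left_transversal_inj[OF l conjunct1[OF k] conjunct1[OF j]])
         (rule trans[OF sym[OF conjunct2[OF k]] conjunct2[OF j]])
  qed
  from theI'[OF this] have P: "?P (transversal_perm G U l x i)"
    unfolding transversal_perm_def .
  show "transversal_perm G U l x i \<in> {1..card (lcosets U)}" by (rule conjunct1[OF P])
  show "(x \<otimes> l i) <# U = l (transversal_perm G U l x i) <# U" by (rule conjunct2[OF P])
qed

lemma (in group) transversal_perm_eqI:
  assumes l: "left_transversal G U l" and x: "x \<in> carrier G" and i: "i \<in> {1..card (lcosets U)}"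
    and "j \<in> {1..card (lcosets U)}" "(x \<otimes> l i) <# U = l j <# U"
  shows "transversal_perm G U l x i = j"
  by (rule left_transversal_inj[OF l transversal_perm(1)[OF l x i] assms(4)])
     (simp flip: transversal_perm(2)[OF l x i] add: assms(5))

text \<open>Left translation by \<open>x\<close> permutes the left cosets. This yields both the injectivity of
  \<open>\<lambda>\<^sub>x\<close> and its conjugation under a change of transversal.\<close>
lemma (in group) translate_l_coset_eq_iff:
  assumes U: "subgroup U G" and "x \<in> carrier G" "a \<in> carrier G" "b \<in> carrier G"
  shows "(x \<otimes> a) <# U = (x \<otimes> b) <# U \<longleftrightarrow> a <# U = b <# U"
proof -
  have "inv (x \<otimes> a) \<otimes> (x \<otimes> b) = inv a \<otimes> b"
    using assms by (simp add: inv_mult_group m_assoc inv_solve_left')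
  then show ?thesis using assms by (simp add: l_coset_eq_iff)
qed

lemma (in group) bij_betw_transversal_perm:
  assumes U: "subgroup U G" and l: "left_transversal G U l" and x: "x \<in> carrier G"
  shows "bij_betw (transversal_perm G U l x) {1..card (lcosets U)} {1..card (lcosets U)}"
proof -
  let ?I = "{1..card (lcosets U)}" and ?s = "transversal_perm G U l x"
  have inj: "inj_on ?s ?I"
  proof (rule inj_onI)
    fix i j assume ij: "i \<in> ?I" "j \<in> ?I" "?s i = ?s j"
    then have "(x \<otimes> l i) <# U = (x \<otimes> l j) <# U"
      using transversal_perm(2)[OF l x] by metis
    then have "l i <# U = l j <# U"
      using translate_l_coset_eq_iff[OF U x] left_transversal_carrier[OF l] ij by simp
    then show "i = j" by (rule left_transversal_inj[OF l ij(1,2)])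
  qed
  moreover have "?s ` ?I \<subseteq> ?I" using transversal_perm(1)[OF l x] by blast
  ultimately show ?thesis
    by (simp add: bij_betw_def endo_inj_surj)
qed

lemma (in group) transfer_factor_in_subgroup:
  assumes U: "subgroup U G" and l: "left_transversal G U l" and x: "x \<in> carrier G"
    and i: "i \<in> {1..card (lcosets U)}"
  shows "inv (l (transversal_perm G U l x i)) \<otimes> x \<otimes> l i \<in> U"
  using l_coset_eq_iff[OF U, of "l (transversal_perm G U l x i)" "x \<otimes> l i"]
    transversal_perm[OF l x i] left_transversal_carrier[OF l] i x
  by (simp add: m_assoc)

text \<open>Let \<open>r\<close> match the two transversals by cosets, so that \<open>l'\<^sub>i = l\<^bsub>r(i)\<^esub> u\<^sub>i\<close> with \<open>u\<^sub>i\<close> in \<open>U\<close>. Then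
  \<open>r\<close> conjugates the permutation \<open>s'\<close> of \<open>x\<close> on \<open>l'\<close> into its permutation \<open>s\<close> on \<open>l\<close>, and the
  factors satisfy \<open>u\<^bsub>s'(i)\<^esub> t'\<^sub>i = t\<^bsub>r(i)\<^esub> u\<^sub>i\<close>. In the product over all \<open>i\<close>, taken in the
  abelian group \<open>U/U'\<close>, the \<open>u\<^sub>i\<close> contribute the same element \<open>P\<close> on both sides, since \<open>s'\<close> is
  a permutation, and \<open>P\<close> cancels.\<close>
lemma (in group) artin_transfer_wrt_unique:
  assumes U: "subgroup U G" and x: "x \<in> carrier G"
    and l: "left_transversal G U l" and l': "left_transversal G U l'"
  shows "artin_transfer_wrt G U l x = artin_transfer_wrt G U l' x"
proof -
  let ?I = "{1..card (lcosets U)}" and ?A = "abelianization G U"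
  let ?s = "transversal_perm G U l x" and ?s' = "transversal_perm G U l' x"
  let ?q = "\<lambda>u. derived G U #> u"
  interpret A: comm_group ?A by (rule abelianization_comm_group[OF U])
  have q: "?q u \<in> carrier ?A" if "u \<in> U" for u
    using that by (simp add: carrier_abelianization)
  have q_mult: "?q (u \<otimes> v) = ?q u \<otimes>\<^bsub>?A\<^esub> ?q v" if "u \<in> U" "v \<in> U" for u v
    using hom_mult[OF abelianization_hom[OF U]] that by simp
  note lc = left_transversal_carrier[OF l] and lc' = left_transversal_carrier[OF l']
  define t where "t i = inv (l (?s i)) \<otimes> x \<otimes> l i" for i
  define t' where "t' i = inv (l' (?s' i)) \<otimes> x \<otimes> l' i" for i
  have t: "t i \<in> U" and t': "t' i \<in> U" if "i \<in> ?I" for i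
    using transfer_factor_in_subgroup[OF U _ x that] l l' by (simp_all add: t_def t'_def)
  define r where "r = inv_into ?I (\<lambda>i. l i <# U) \<circ> (\<lambda>i. l' i <# U)"
  have bl: "bij_betw (\<lambda>i. l i <# U) ?I (lcosets U)" and bl': "bij_betw (\<lambda>i. l' i <# U) ?I (lcosets U)"
    using l l' by (auto simp: left_transversal_def)
  have r_bij: "bij_betw r ?I ?I"
    unfolding r_def by (rule bij_betw_trans[OF bl' bij_betw_inv_into[OF bl]])
  have r: "r i \<in> ?I" if "i \<in> ?I" for i
    using bij_betwE[OF r_bij] that by blast
  have r_coset: "l (r i) <# U = l' i <# U" if "i \<in> ?I" for i
  proof -
    have "l' i <# U \<in> lcosets U" using bij_betwE[OF bl'] that by blast
    from bij_betw_inv_into_right[OF bl this] show ?thesis by (simp add: r_def)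
  qed
  define u where "u i = inv (l (r i)) \<otimes> l' i" for i
  have u: "u i \<in> U" if "i \<in> ?I" for i
    using l_coset_eq_iff[OF U] r_coset lc lc' r that by (simp add: u_def)
  have s'_in: "?s' i \<in> ?I" if "i \<in> ?I" for i
    by (rule transversal_perm(1)[OF l' x that])
  have r_s': "r (?s' i) = ?s (r i)" if i: "i \<in> ?I" for i
  proof -
    have "(x \<otimes> l (r i)) <# U = (x \<otimes> l' i) <# U"
      using translate_l_coset_eq_iff[OF U x] r_coset lc lc' r i by simp
    also have "\<dots> = l (r (?s' i)) <# U"
      using transversal_perm(2)[OF l' x i] r_coset[OF s'_in[OF i]] by simp
    finally have "?s (r i) = r (?s' i)"
      by (rule transversal_perm_eqI[OF l x r[OF i] r[OF s'_in[OF i]]])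
    then show ?thesis ..
  qed
  have key: "u (?s' i) \<otimes> t' i = t (r i) \<otimes> u i" if i: "i \<in> ?I" for i
  proof -
    have c: "l (r i) \<in> carrier G" "l' i \<in> carrier G" "l' (?s' i) \<in> carrier G"
        "l (?s (r i)) \<in> carrier G"
      using i r s'_in lc lc' by (simp_all flip: r_s')
    have cancel: "a \<otimes> (inv a \<otimes> b) = b" if "a \<in> carrier G" "b \<in> carrier G" for a b
      using that by (simp flip: m_assoc)
    have "u (?s' i) \<otimes> t' i = inv (l (?s (r i))) \<otimes> (l' (?s' i) \<otimes> inv (l' (?s' i))) \<otimes> x \<otimes> l' i"
      using c x by (simp add: u_def t'_def r_s'[OF i] m_assoc cancel)
    also have "\<dots> = inv (l (?s (r i))) \<otimes> x \<otimes> (l (r i) \<otimes> inv (l (r i))) \<otimes> l' i"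
      using c x by simp
    also have "\<dots> = t (r i) \<otimes> u i"
      using c x by (simp add: u_def t_def m_assoc cancel)
    finally show ?thesis .
  qed
  define P where "P = (\<Otimes>\<^bsub>?A\<^esub>i\<in>?I. ?q (u i))"
  have P: "P \<in> carrier ?A" unfolding P_def using u q by (intro A.finprod_closed) auto
  have T: "artin_transfer_wrt G U l x = (\<Otimes>\<^bsub>?A\<^esub>i\<in>?I. ?q (t i))"
    and T': "artin_transfer_wrt G U l' x = (\<Otimes>\<^bsub>?A\<^esub>i\<in>?I. ?q (t' i))"
    by (simp_all add: artin_transfer_wrt_def t_def t'_def)
  have closed: "artin_transfer_wrt G U l x \<in> carrier ?A" "artin_transfer_wrt G U l' x \<in> carrier ?A"
    unfolding T T' using t t' q by (auto intro!: A.finprod_closed)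
  have "P = (\<Otimes>\<^bsub>?A\<^esub>i\<in>?I. ?q (u (?s' i)))"
    using A.finprod_reindex[of "\<lambda>i. ?q (u i)" ?s' ?I] bij_betw_transversal_perm[OF U l' x] u q
    by (auto simp: P_def bij_betw_def)
  then have "P \<otimes>\<^bsub>?A\<^esub> artin_transfer_wrt G U l' x
      = (\<Otimes>\<^bsub>?A\<^esub>i\<in>?I. ?q (u (?s' i)) \<otimes>\<^bsub>?A\<^esub> ?q (t' i))"
    unfolding T' using u t' q s'_in by (simp add: A.finprod_multf Pi_def)
  also have "\<dots> = (\<Otimes>\<^bsub>?A\<^esub>i\<in>?I. ?q (t (r i)) \<otimes>\<^bsub>?A\<^esub> ?q (u i))"
  proof (rule A.finprod_cong')
    show "?q (u (?s' i)) \<otimes>\<^bsub>?A\<^esub> ?q (t' i) = ?q (t (r i)) \<otimes>\<^bsub>?A\<^esub> ?q (u i)" if "i \<in> ?I" for i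
      using arg_cong[OF key[OF that], of ?q]
      by (simp only: q_mult[OF u[OF s'_in[OF that]] t'[OF that]] q_mult[OF t[OF r[OF that]] u[OF that]])
  qed (use u t r q in auto)
  also have "\<dots> = (\<Otimes>\<^bsub>?A\<^esub>i\<in>?I. ?q (t (r i))) \<otimes>\<^bsub>?A\<^esub> P"
    unfolding P_def using u t q r by (intro A.finprod_multf) auto
  also have "(\<Otimes>\<^bsub>?A\<^esub>i\<in>?I. ?q (t (r i))) = artin_transfer_wrt G U l x"
    unfolding T using A.finprod_reindex[of "\<lambda>i. ?q (t i)" r ?I] r_bij t q
    by (auto simp: bij_betw_def)
  finally show ?thesis
    using closed P by (simp add: A.m_comm)
qed

lemma finprod_hom:
  assumes "comm_group A" "comm_group B" and f: "f \<in> hom A B" and g: "g \<in> I \<rightarrow> carrier A"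
  shows "f (finprod A g I) = (\<Otimes>\<^bsub>B\<^esub>i\<in>I. f (g i))"
proof -
  interpret A: comm_group A by fact
  interpret B: comm_group B by fact
  interpret group_hom A B f using f by unfold_locales
  show ?thesis
    using g by (induction I rule: infinite_finite_induct) (auto simp: Pi_def)
qed

text \<open>Because the kernel lies in \<open>U\<close>, the preimage of \<open>h U\<close> is \<open>U\<close> itself, so distinct cosets of \<open>U\<close>
  have distinct images.\<close>
lemma (in group_hom) img_l_coset_eq_iff:
  assumes U: "subgroup U G" and ker: "kernel G H h \<subseteq> U" and x: "x \<in> carrier G" and y: "y \<in> carrier G"
  shows "h x <#\<^bsub>H\<^esub> h ` U = h y <#\<^bsub>H\<^esub> h ` U \<longleftrightarrow> x <# U = y <# U"
proof -
  have mem: "z \<in> U" if z: "z \<in> carrier G" "h z \<in> h ` U" for z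
  proof -
    obtain u where u: "u \<in> U" "h z = h u" using z by blast
    have uc: "u \<in> carrier G" using u subgroup.mem_carrier[OF U] by simp
    then have "z \<otimes> inv u \<in> kernel G H h" using u z by (simp add: kernel_def)
    then have "z \<otimes> inv u \<otimes> u \<in> U" using ker u subgroup.m_closed[OF U] by blast
    then show ?thesis using z uc by (simp add: G.m_assoc)
  qed
  have "h x <#\<^bsub>H\<^esub> h ` U = h y <#\<^bsub>H\<^esub> h ` U \<longleftrightarrow> h (inv x \<otimes> y) \<in> h ` U"
    using H.l_coset_eq_iff[OF subgroup_img_is_subgroup[OF U]] x y by simp
  also have "\<dots> \<longleftrightarrow> inv x \<otimes> y \<in> U"
    using mem[of "inv x \<otimes> y"] x y by (blast intro: G.m_closed G.inv_closed)
  finally show ?thesis using G.l_coset_eq_iff[OF U x y] by simp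
qed

text \<open>Equality of the indices is part of the conclusion because the index is the length of the
  transversal and hence the range of the transfer product.\<close>
lemma (in group_hom) left_transversal_img:
  assumes U: "subgroup U G" and ker: "kernel G H h \<subseteq> U" and surj: "h ` carrier G = carrier H"
    and l: "left_transversal G U l"
  shows "card (lcosets\<^bsub>H\<^esub> (h ` U)) = card (lcosets U)"
    and "left_transversal H (h ` U) (h \<circ> l)"
proof -
  let ?I = "{1..card (lcosets U)}"
  note lc = G.left_transversal_carrier[OF l]
  have bij: "bij_betw (\<lambda>i. h (l i) <#\<^bsub>H\<^esub> h ` U) ?I (lcosets\<^bsub>H\<^esub> (h ` U))"
    unfolding bij_betw_def
  proof
    show "inj_on (\<lambda>i. h (l i) <#\<^bsub>H\<^esub> h ` U) ?I"
    proof (rule inj_onI)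
      fix i j assume i: "i \<in> ?I" and j: "j \<in> ?I"
        and "h (l i) <#\<^bsub>H\<^esub> h ` U = h (l j) <#\<^bsub>H\<^esub> h ` U"
      then have "l i <# U = l j <# U"
        using img_l_coset_eq_iff[OF U ker lc[OF i] lc[OF j]] by simp
      then show "i = j" by (rule G.left_transversal_inj[OF l i j])
    qed
    show "(\<lambda>i. h (l i) <#\<^bsub>H\<^esub> h ` U) ` ?I = lcosets\<^bsub>H\<^esub> (h ` U)"
    proof
      have "h (l i) <#\<^bsub>H\<^esub> h ` U \<in> lcosets\<^bsub>H\<^esub> (h ` U)" if "i \<in> ?I" for i
        using hom_closed[OF lc[OF that]] unfolding LCOSETS_def by blast
      then show "(\<lambda>i. h (l i) <#\<^bsub>H\<^esub> h ` U) ` ?I \<subseteq> lcosets\<^bsub>H\<^esub> (h ` U)"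
        by blast
      show "lcosets\<^bsub>H\<^esub> (h ` U) \<subseteq> (\<lambda>i. h (l i) <#\<^bsub>H\<^esub> h ` U) ` ?I"
      proof
        fix Y assume "Y \<in> lcosets\<^bsub>H\<^esub> (h ` U)"
        then obtain x where x: "x \<in> carrier G" "Y = h x <#\<^bsub>H\<^esub> h ` U"
          unfolding LCOSETS_def surj[symmetric] by blast
        then have "x <# U \<in> lcosets U" by (auto simp: LCOSETS_def)
        then obtain i where i: "i \<in> ?I" "x <# U = l i <# U"
          using l unfolding left_transversal_def bij_betw_def by blast
        have "Y = h (l i) <#\<^bsub>H\<^esub> h ` U"
          using img_l_coset_eq_iff[OF U ker x(1) lc[OF i(1)]] i(2) x(2) by simp
        then show "Y \<in> (\<lambda>i. h (l i) <#\<^bsub>H\<^esub> h ` U) ` ?I"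
          using i(1) by blast
      qed
    qed
  qed
  from bij_betw_same_card[OF bij] show card: "card (lcosets\<^bsub>H\<^esub> (h ` U)) = card (lcosets U)"
    by simp
  show "left_transversal H (h ` U) (h \<circ> l)"
    using bij lc by (auto simp: left_transversal_def card)
qed

text \<open>With the transversal \<open>h \<circ> l\<close> of \<open>h U\<close>, the element \<open>h x\<close> permutes the cosets exactly as \<open>x\<close> does
  with \<open>l\<close>, and the induced map sends the transfer product of \<open>x\<close> factor by factor to that of
  \<open>h x\<close>. The transversal that defines the transfer of \<open>H\<close> is unrelated to \<open>h \<circ> l\<close>, so
  independence of the transversal is needed here.\<close>
lemma (in group_hom) artin_transfer_img:
  assumes U: "subgroup U G" and ker: "kernel G H h \<subseteq> U" and surj: "h ` carrier G = carrier H"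
    and fin: "finite (lcosets U)" "finite (lcosets\<^bsub>H\<^esub> (h ` U))" and x: "x \<in> carrier G"
  shows "artin_transfer H (h ` U) (h x) = induced_map H h (h ` U) (artin_transfer G U x)"
proof -
  let ?I = "{1..card (lcosets U)}" and ?A = "abelianization G U" and ?V = "h ` U"
  let ?B = "abelianization H ?V"
  obtain l where l: "left_transversal G U l" and T: "artin_transfer G U = artin_transfer_wrt G U l"
    using G.artin_transfer_eq_wrt_some[OF fin(1)] by blast
  obtain l' where l': "left_transversal H ?V l'"
    and T': "artin_transfer H ?V = artin_transfer_wrt H ?V l'"
    using H.artin_transfer_eq_wrt_some[OF fin(2)] by blast
  have V: "subgroup ?V H" by (rule subgroup_img_is_subgroup[OF U])
  note card = left_transversal_img(1)[OF U ker surj l] and hl = left_transversal_img(2)[OF U ker surj l]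
  note lc = G.left_transversal_carrier[OF l]
  let ?s = "transversal_perm G U l x"
  have s: "?s i \<in> ?I" "(x \<otimes> l i) <# U = l (?s i) <# U" if "i \<in> ?I" for i
    using G.transversal_perm[OF l x that] by auto
  have perm: "transversal_perm H ?V (h \<circ> l) (h x) i = ?s i" if i: "i \<in> ?I" for i
  proof (rule H.transversal_perm_eqI[OF hl])
    have "h (x \<otimes> l i) <#\<^bsub>H\<^esub> ?V = h (l (?s i)) <#\<^bsub>H\<^esub> ?V"
      using img_l_coset_eq_iff[OF U ker, of "x \<otimes> l i" "l (?s i)"] s[OF i] x lc[OF i] lc[OF s(1)[OF i]]
      by simp
    then show "(h x \<otimes>\<^bsub>H\<^esub> (h \<circ> l) i) <#\<^bsub>H\<^esub> ?V = (h \<circ> l) (?s i) <#\<^bsub>H\<^esub> ?V"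
      using x lc[OF i] by simp
  qed (use x i s card in auto)
  define t where "t i = inv (l (?s i)) \<otimes> x \<otimes> l i" for i
  have t: "t i \<in> U" if "i \<in> ?I" for i
    unfolding t_def by (rule G.transfer_factor_in_subgroup[OF U l x that])
  have "artin_transfer H ?V (h x) = artin_transfer_wrt H ?V (h \<circ> l) (h x)"
    unfolding T' by (rule H.artin_transfer_wrt_unique[OF V _ l' hl]) (use x in simp)
  also have "\<dots> = (\<Otimes>\<^bsub>?B\<^esub>i\<in>?I. induced_map H h ?V (derived G U #> t i))"
    unfolding artin_transfer_wrt_def card
  proof (rule comm_monoid.finprod_cong')
    show "comm_monoid ?B"
      using H.abelianization_comm_group[OF V] by (simp add: comm_group_def)
    show "(\<lambda>i. induced_map H h ?V (derived G U #> t i)) \<in> ?I \<rightarrow> carrier ?B"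
      using t by (auto simp: induced_map_coset[OF U] carrier_abelianization)
    fix i assume i: "i \<in> ?I"
    have "h (t i) = inv\<^bsub>H\<^esub> (h (l (?s i))) \<otimes>\<^bsub>H\<^esub> h x \<otimes>\<^bsub>H\<^esub> h (l i)"
      using lc[OF i] lc[OF s(1)[OF i]] x by (simp add: t_def)
    then show "derived H ?V #>\<^bsub>H\<^esub> (inv\<^bsub>H\<^esub> ((h \<circ> l) (transversal_perm H ?V (h \<circ> l) (h x) i))
        \<otimes>\<^bsub>H\<^esub> h x \<otimes>\<^bsub>H\<^esub> (h \<circ> l) i) = induced_map H h ?V (derived G U #> t i)"
      by (simp add: perm[OF i] induced_map_coset[OF U t[OF i]])
  qed simp
  also have "\<dots> = induced_map H h ?V (\<Otimes>\<^bsub>?A\<^esub>i\<in>?I. derived G U #> t i)"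
    using t
    by (intro finprod_hom[symmetric] G.abelianization_comm_group[OF U]
          H.abelianization_comm_group[OF V] group_hom.homh[OF induced_map_epi(1)[OF U]])
       (auto simp: carrier_abelianization)
  also have "(\<Otimes>\<^bsub>?A\<^esub>i\<in>?I. derived G U #> t i) = artin_transfer G U x"
    by (simp add: T artin_transfer_wrt_def t_def)
  finally show ?thesis .
qed

lemma (in group_hom) artin_transfer_kernel_img:
  assumes U: "subgroup U G" and ker: "kernel G H h \<subseteq> U" and surj: "h ` carrier G = carrier H"
    and fin: "finite (lcosets U)" "finite (lcosets\<^bsub>H\<^esub> (h ` U))"
  shows "h ` kernel G (abelianization G U) (artin_transfer G U)
    \<subseteq> kernel H (abelianization H (h ` U)) (artin_transfer H (h ` U))"
proof -
  interpret ind: group_hom "abelianization G U" "abelianization H (h ` U)" "induced_map H h (h ` U)"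
    by (rule induced_map_epi(1)[OF U])
  show ?thesis
  proof
    fix y assume "y \<in> h ` kernel G (abelianization G U) (artin_transfer G U)"
    then obtain x where x: "x \<in> carrier G" and y: "y = h x"
      and T: "artin_transfer G U x = \<one>\<^bsub>abelianization G U\<^esub>"
      unfolding kernel_def by blast
    have "artin_transfer H (h ` U) y = \<one>\<^bsub>abelianization H (h ` U)\<^esub>"
      unfolding y artin_transfer_img[OF U ker surj fin x] T by (rule ind.hom_one)
    then show "y \<in> kernel H (abelianization H (h ` U)) (artin_transfer H (h ` U))"
      using hom_closed[OF x] by (simp add: kernel_def y)
  qed
qed

lemma (in group_hom) abelianization_img_iso:
  assumes "subgroup U G"
  shows "abelianization H (h ` U) \<cong> abelianization G U Mod
    kernel (abelianization G U) (abelianization H (h ` U)) (induced_map H h (h ` U))"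
proof -
  interpret ind: group_hom "abelianization G U" "abelianization H (h ` U)" "induced_map H h (h ` U)"
    by (rule induced_map_epi(1)[OF assms])
  show ?thesis
    using group.iso_sym[OF normal.factorgroup_is_group[OF ind.normal_kernel]
        ind.FactGroup_iso[OF induced_map_epi(2)[OF assms]]] .
qed


section \<open>Comparability of the Artin patterns\<close>

theorem theorem5p3:
  fixes p n :: nat and R G H :: "'a monoid" and kind :: parent_kind
    and I :: "'i set" and U V :: "'i \<Rightarrow> 'a set" and \<phi> :: "'a \<Rightarrow> 'a"
  assumes "prime p"
    and "finite_p_group p R" and "comm_group R" and "carrier R \<noteq> {\<one>\<^bsub>R\<^esub>}"
    and "tree_object kind p R I G U"
    and restriction: "\<And>i. i \<in> I \<Longrightarrow>
      (case kind of
         Lower_Central \<Rightarrow> lower_central G 2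
       | Lower_Exponent_Central \<Rightarrow> lower_exponent_central p G 1
       | Derived_Series \<Rightarrow> derived_series G 1) \<subseteq> U i"
    and "H \<in> descendant_tree kind p R" and "iterated_parent kind p n G \<phi> H"
    and "\<And>i. i \<in> I \<Longrightarrow> V i = \<phi> ` U i"
  shows "(\<forall>i\<in>I. kernel G H \<phi> \<subseteq> U i) \<and>
         tree_morphism kind p R I G U \<phi> H V \<and>
         targets_le I \<phi> H V G U \<and>
         kernels_le I \<phi> G U H V"
proof -
  have G: "group G"
    using assms(5) by (auto simp: tree_object_def descendant_tree_def finite_p_group_def)
  have R: "group R" using assms(2) by (simp add: finite_p_group_def)
  have U: "subgroup (U i) G" "finite (lcosets\<^bsub>G\<^esub> U i)" if "i \<in> I" for i
    using assms(5) that by (auto simp: tree_object_def)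
  have V: "V i = \<phi> ` U i" if "i \<in> I" for i by (rule assms(9)[OF that])
  interpret \<phi>: group_hom G H \<phi> by (rule iterated_parent_epi(1)[OF assms(8) G])
  have surj: "\<phi> ` carrier G = carrier H" by (rule iterated_parent_epi(2)[OF assms(8) G])
  have "kernel G H \<phi> \<subseteq> descending_series kind p G 1"
    using iterated_parent_epi(3)[OF assms(8) G] descendant_nontrivial[OF assms(7) assms(4) R] .
  moreover have "descending_series kind p G 1 \<subseteq> U i" if "i \<in> I" for i
    using restriction[OF that]
    by (cases kind) (simp_all add: descending_series_def numeral_2_eq_2)
  ultimately have ker: "kernel G H \<phi> \<subseteq> U i" if "i \<in> I" for i
    using that by blast
  have "finite (carrier H)"
    using assms(7) by (simp add: descendant_tree_def finite_p_group_def)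
  then have fin: "finite (lcosets\<^bsub>H\<^esub> X)" for X
    by (simp add: LCOSETS_def)
  have "tree_object kind p R I H V"
    using assms(7) fin U V by (simp add: tree_object_def \<phi>.subgroup_img_is_subgroup)
  then have "tree_morphism kind p R I G U \<phi> H V"
    using assms(5,8) ker V unfolding tree_morphism_def by auto
  moreover have "targets_le I \<phi> H V G U"
    using \<phi>.abelianization_img_iso[OF U(1)] by (simp add: targets_le_def transfer_targets_def V)
  moreover have "kernels_le I \<phi> G U H V"
    unfolding kernels_le_def transfer_kernels_def
  proof
    fix i assume i: "i \<in> I"
    show "\<phi> ` kernel G (abelianization G (U i)) (artin_transfer G (U i))
        \<subseteq> kernel H (abelianization H (V i)) (artin_transfer H (V i))"
      unfolding V[OF i]
      by (rule \<phi>.artin_transfer_kernel_img[OF U(1)[OF i] ker[OF i] surj U(2)[OF i] fin])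
  qed
  ultimately show ?thesis using ker by blast
qed

end
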